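(* Let $(\mathsf V,\otimes,I)$ be a monoidal category and let $\mathsf R$ be the associated $\mathsf{Lax}_0\mathsf{Oplax}_+$-monoidal category of objects of $\mathsf V$ equipped with two commuting endomorphisms (described in the context). Then: (1) The category of semigroups in $\mathsf R$ (regarded as an $\mathsf{Oplax}_+$-monoidal category) and the category of BiHom-monoids in $\mathsf V$ are isomorphic. (2) The category of monoids in the $\mathsf{Lax}_0\mathsf{Oplax}_+$-monoidal category $\mathsf R$ and the category of unital BiHom-monoids in $\mathsf V$ are isomorphic.
   Context: Mac Lane coherence isomorphisms of $\mathsf V$ are suppressed; $gf$ means first $f$, then $g$. For $m\in\mathbb N$ put $Z(m)=1$ if $m=0$ and $Z(m)=0$ otherwise, and $\overline m=m+Z(m)$. The category $\mathsf R$: an object is a triple $(a,\kappa,\nu)$ with $a$ an object of $\mathsf V$ and $\kappa,\nu:a\to a$ with $\kappa\nu=\nu\kappa$; a morphism $(a,\kappa,\nu)\to(a',\kappa',\nu')$ is $\vartheta:a\to a'$ in $\mathsf V$ with $\vartheta\kappa=\kappa'\vartheta$, $\vartheta\nu=\nu'\vartheta$. Its product functors $\circ_n:\mathsf R^n\to\mathsf R$ are: $\circ_0=(I,1,1)$, $\circ_1=$ identity functor, and for $n>1$, $\circ_n$ is the $n$-fold product $(a_1\otimes\cdots\otimes a_n,\kappa_1\otimes\cdots\otimes\kappa_n,\nu_1\otimes\cdots\otimes\nu_n)$, acting on morphisms by $\vartheta_1\otimes\cdots\otimes\vartheta_n$. The coherence transformations are $\upsilon=1$ and, for $n,k_1,\dots,k_n\in\mathbb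 N$, at objects $(a_{ij},\kappa_{ij},\nu_{ij})$ ($1\le i\le n$, $1\le j\le k_i$), the endomorphisms of $\otimes_{i=1}^n\otimes_{j=1}^{k_i}a_{ij}$ $$\Psi_{k_1,\dots,k_n}=\otimes_{i}\otimes_{j}\kappa_{ij}^{\sum_{p=i+1}^n(\overline k_p-1)}\nu_{ij}^{\sum_{p=1}^{i-1}(\overline k_p-1)},\qquad \psi_{k_1,\dots,k_n}=\otimes_{i}\otimes_{j}\kappa_{ij}^{\sum_{p=i+1}^nZ(k_p)}\nu_{ij}^{\sum_{p=1}^{i-1}Z(k_p)}.$$ Here both have as source the $(\sum_i\overline k_i)$-fold product in which a unit object $\circ_0$ is inserted in the $i$th place for each $i$ with $k_i=0$; $\Psi_{k_1,\dots,k_n}$ goes to the $n$-fold product of the $k_i$-fold products, and $\psi_{k_1,\dots,k_n}$ goes to the $(\sum_ik_i)$-fold product. A semigroup in an $\mathsf{Oplax}_+$-monoidal category (category with products $\circ_n$, $n\ge1$, and coherence transformations $\Psi_{k_1,\dots,k_n}$ for positive indices and $\upsilon:\circ_1\to1$) is an object $a$ with $\mu:a\circ a\to a$ such that $\mu(\mu\circ\upsilon_a)\Psi_{2,1}=\mu(\upsilon_a\circ\mu)\Psi_{1,2}$; a morphism of semigroups $(a,\mu)\to(a',\mu')$ is $f:a\to a'$ with $f\mu=\mu'(f\circ f)$. A monoid in a $\mathsf{Lax}_0\mathsf{Oplax}_+$-monoidal category with nullary product $i=\circ_0$ is a semigroup $(a,\mu)$ with $\eta:i\to a$ such that $\mu(\eta\circ1)=\upsilon_a\psi_{0,1}$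 and $\mu(1\circ\eta)=\upsilon_a\psi_{1,0}$; a monoid morphism is a semigroup morphism $f$ with $f\eta=\eta'$. A BiHom-monoid in $\mathsf V$ is an object $a$ with $\kappa,\nu:a\to a$ and $\mu:a\otimes a\to a$ such that $\kappa\nu=\nu\kappa$, $\kappa\mu=\mu(\kappa\otimes\kappa)$, $\nu\mu=\mu(\nu\otimes\nu)$ and $\mu(\mu\otimes1)(1\otimes1\otimes\nu)=\mu(1\otimes\mu)(\kappa\otimes1\otimes1)$. It is unital if equipped with $\eta:I\to a$ with $\kappa\eta=\eta=\nu\eta$, $\mu(\eta\otimes1)=\nu$, $\mu(1\otimes\eta)=\kappa$. Morphisms of (unital) BiHom-monoids are morphisms $f$ of $\mathsf V$ commuting with the $\kappa$'s and $\nu$'s and satisfying $f\mu=\mu'(f\otimes f)$ (and $f\eta=\eta'$). *)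

theory Defs
  imports Main
begin

record ('o, 'm) cat =
  Obj :: "'o set"
  Arr :: "'m set"
  Dom :: "'m \<Rightarrow> 'o"
  Cod :: "'m \<Rightarrow> 'o"
  Ident :: "'o \<Rightarrow> 'm"
  Comp :: "'m \<Rightarrow> 'm \<Rightarrow> 'm" (infixl "\<cdot>\<index>" 65)

definition hom :: "('o, 'm, 'z) cat_scheme \<Rightarrow> 'o \<Rightarrow> 'o \<Rightarrow> 'm set" where
  "hom C a b = {f \<in> Arr C. Dom C f = a \<and> Cod C f = b}"

locale category =
  fixes C :: "('o, 'm, 'z) cat_scheme" (structure)
  assumes Dom_Obj: "f \<in> Arr C \<Longrightarrow> Dom C f \<in> Obj C"
    and Cod_Obj: "f \<in> Arr C \<Longrightarrow> Cod C f \<in> Obj C"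
    and Ident_hom: "a \<in> Obj C \<Longrightarrow> Ident C a \<in> hom C a a"
    and Comp_hom: "\<lbrakk>f \<in> hom C a b; g \<in> hom C b c\<rbrakk> \<Longrightarrow> g \<cdot> f \<in> hom C a c"
    and Comp_Ident_right: "f \<in> hom C a b \<Longrightarrow> f \<cdot> Ident C a = f"
    and Comp_Ident_left: "f \<in> hom C a b \<Longrightarrow> Ident C b \<cdot> f = f"
    and Comp_assoc:
      "\<lbrakk>f \<in> hom C a b; g \<in> hom C b c; h \<in> hom C c d\<rbrakk> \<Longrightarrow> (h \<cdot> g) \<cdot> f = h \<cdot> (g \<cdot> f)"

definition inverse_arrows :: "('o, 'm, 'z) cat_scheme \<Rightarrow> 'm \<Rightarrow> 'm \<Rightarrow> bool" where
  "inverse_arrows C f g \<longleftrightarrow>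
     (\<exists>a b. f \<in> hom C a b \<and> g \<in> hom C b a \<and>
        g \<cdot>\<^bsub>C\<^esub> f = Ident C a \<and> f \<cdot>\<^bsub>C\<^esub> g = Ident C b)"

definition iso_arr :: "('o, 'm, 'z) cat_scheme \<Rightarrow> 'm \<Rightarrow> bool" where
  "iso_arr C f \<longleftrightarrow> (\<exists>g. inverse_arrows C f g)"

definition inv_arr :: "('o, 'm, 'z) cat_scheme \<Rightarrow> 'm \<Rightarrow> 'm" where
  "inv_arr C f = (THE g. inverse_arrows C f g)"

fun arr_pow :: "('o, 'm, 'z) cat_scheme \<Rightarrow> 'm \<Rightarrow> nat \<Rightarrow> 'm" where
  "arr_pow C f 0 = Ident C (Dom C f)"
| "arr_pow C f (Suc n) = f \<cdot>\<^bsub>C\<^esub> arr_pow C f n"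

definition is_functor ::
  "('o, 'm, 'z) cat_scheme \<Rightarrow> ('p, 'n, 'y) cat_scheme \<Rightarrow> ('o \<Rightarrow> 'p) \<Rightarrow> ('m \<Rightarrow> 'n) \<Rightarrow> bool" where
  "is_functor C D Fo Fa \<longleftrightarrow>
     category C \<and> category D \<and>
     (\<forall>a \<in> Obj C. Fo a \<in> Obj D) \<and>
     (\<forall>a b. \<forall>f \<in> hom C a b. Fa f \<in> hom D (Fo a) (Fo b)) \<and>
     (\<forall>a \<in> Obj C. Fa (Ident C a) = Ident D (Fo a)) \<and>
     (\<forall>a b c. \<forall>f \<in> hom C a b. \<forall>g \<in> hom C b c. Fa (g \<cdot>\<^bsub>C\<^esub> f) = Fa g \<cdot>\<^bsub>D\<^esub> Fa f)"

definition isomorphic_categories ::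
  "('o, 'm, 'z) cat_scheme \<Rightarrow> ('p, 'n, 'y) cat_scheme \<Rightarrow> bool" where
  "isomorphic_categories C D \<longleftrightarrow>
     (\<exists>Fo Fa Go Ga. is_functor C D Fo Fa \<and> is_functor D C Go Ga \<and>
        (\<forall>a \<in> Obj C. Go (Fo a) = a) \<and> (\<forall>f \<in> Arr C. Ga (Fa f) = f) \<and>
        (\<forall>b \<in> Obj D. Fo (Go b) = b) \<and> (\<forall>g \<in> Arr D. Fa (Ga g) = g))"

text \<open>
  The category of objects of \<open>C\<close> with extra structure: \<open>S\<close> is the set of structured objects,
  \<open>U\<close> the underlying object, and \<open>P X Y f\<close> says that the arrow \<open>f : U X \<rightarrow> U Y\<close> preserves the
  structure. As one \<open>f\<close> may preserve several structures, an arrow is a triple \<open>(X, f, Y)\<close>.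
\<close>
definition structured_cat ::
  "('o, 'm, 'z) cat_scheme \<Rightarrow> 's set \<Rightarrow> ('s \<Rightarrow> 'o) \<Rightarrow> ('s \<Rightarrow> 's \<Rightarrow> 'm \<Rightarrow> bool) \<Rightarrow>
     ('s, 's \<times> 'm \<times> 's) cat" where
  "structured_cat C S U P =
     \<lparr>Obj = S,
      Arr = {(X, f, Y). X \<in> S \<and> Y \<in> S \<and> f \<in> hom C (U X) (U Y) \<and> P X Y f},
      Dom = (\<lambda>(X, f, Y). X),
      Cod = (\<lambda>(X, f, Y). Y),
      Ident = (\<lambda>X. (X, Ident C (U X), X)),
      Comp = (\<lambda>(Y', g, Z) (X, f, Y). (X, g \<cdot>\<^bsub>C\<^esub> f, Z))\<rparr>"


section \<open>Monoidal categories\<close>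

record ('o, 'm) moncat = "('o, 'm) cat" +
  TensO :: "'o \<Rightarrow> 'o \<Rightarrow> 'o" (infixr "\<otimes>\<^sub>o\<index>" 75)
  TensM :: "'m \<Rightarrow> 'm \<Rightarrow> 'm" (infixr "\<otimes>\<index>" 75)
  Unit :: "'o"
  Assoc :: "'o \<Rightarrow> 'o \<Rightarrow> 'o \<Rightarrow> 'm"
  Lunit :: "'o \<Rightarrow> 'm"
  Runit :: "'o \<Rightarrow> 'm"

locale monoidal_category = category V
  for V :: "('o, 'm, 'z) moncat_scheme" (structure) +
  assumes TensO_Obj: "\<lbrakk>a \<in> Obj V; b \<in> Obj V\<rbrakk> \<Longrightarrow> a \<otimes>\<^sub>o b \<in> Obj V"
    and TensM_hom:
      "\<lbrakk>f \<in> hom V a b; g \<in> hom V c d\<rbrakk> \<Longrightarrow> f \<otimes> g \<in> hom V (a \<otimes>\<^sub>o c) (b \<otimes>\<^sub>o d)"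
    and TensM_Ident:
      "\<lbrakk>a \<in> Obj V; b \<in> Obj V\<rbrakk> \<Longrightarrow> Ident V a \<otimes> Ident V b = Ident V (a \<otimes>\<^sub>o b)"
    and TensM_Comp:
      "\<lbrakk>f \<in> hom V a b; g \<in> hom V b c; f' \<in> hom V a' b'; g' \<in> hom V b' c'\<rbrakk>
        \<Longrightarrow> (g \<cdot> f) \<otimes> (g' \<cdot> f') = (g \<otimes> g') \<cdot> (f \<otimes> f')"
    and Unit_Obj: "Unit V \<in> Obj V"
    and Assoc_hom:
      "\<lbrakk>a \<in> Obj V; b \<in> Obj V; c \<in> Obj V\<rbrakk>
        \<Longrightarrow> Assoc V a b c \<in> hom V ((a \<otimes>\<^sub>o b) \<otimes>\<^sub>o c) (a \<otimes>\<^sub>o (b \<otimes>\<^sub>o c))"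
    and Assoc_iso:
      "\<lbrakk>a \<in> Obj V; b \<in> Obj V; c \<in> Obj V\<rbrakk> \<Longrightarrow> iso_arr V (Assoc V a b c)"
    and Assoc_natural:
      "\<lbrakk>f \<in> hom V a a'; g \<in> hom V b b'; h \<in> hom V c c'\<rbrakk>
        \<Longrightarrow> Assoc V a' b' c' \<cdot> ((f \<otimes> g) \<otimes> h) = (f \<otimes> (g \<otimes> h)) \<cdot> Assoc V a b c"
    and Lunit_hom: "a \<in> Obj V \<Longrightarrow> Lunit V a \<in> hom V (Unit V \<otimes>\<^sub>o a) a"
    and Lunit_iso: "a \<in> Obj V \<Longrightarrow> iso_arr V (Lunit V a)"
    and Lunit_natural:
      "f \<in> hom V a b \<Longrightarrow> Lunit V b \<cdot> (Ident V (Unit V) \<otimes> f) = f \<cdot> Lunit V a"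
    and Runit_hom: "a \<in> Obj V \<Longrightarrow> Runit V a \<in> hom V (a \<otimes>\<^sub>o Unit V) a"
    and Runit_iso: "a \<in> Obj V \<Longrightarrow> iso_arr V (Runit V a)"
    and Runit_natural:
      "f \<in> hom V a b \<Longrightarrow> Runit V b \<cdot> (f \<otimes> Ident V (Unit V)) = f \<cdot> Runit V a"
    and pentagon:
      "\<lbrakk>a \<in> Obj V; b \<in> Obj V; c \<in> Obj V; d \<in> Obj V\<rbrakk>
        \<Longrightarrow> Assoc V a b (c \<otimes>\<^sub>o d) \<cdot> Assoc V (a \<otimes>\<^sub>o b) c d =
            (Ident V a \<otimes> Assoc V b c d) \<cdot> Assoc V a (b \<otimes>\<^sub>o c) d \<cdot> (Assoc V a b c \<otimes> Ident V d)"
    and triangle: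
      "\<lbrakk>a \<in> Obj V; b \<in> Obj V\<rbrakk>
        \<Longrightarrow> (Ident V a \<otimes> Lunit V b) \<cdot> Assoc V a (Unit V) b = Runit V a \<otimes> Ident V b"

text \<open>
  The \<open>n\<close>-fold tensor product of a list of length \<open>n\<close>, bracketed to the right; the product of the
  empty list is the unit and the product of a one-element list is its element.
\<close>
fun tensO_list :: "('o, 'm, 'z) moncat_scheme \<Rightarrow> 'o list \<Rightarrow> 'o" where
  "tensO_list V [] = Unit V"
| "tensO_list V [a] = a"
| "tensO_list V (a # b # as) = a \<otimes>\<^sub>o\<^bsub>V\<^esub> tensO_list V (b # as)"

fun tensM_list :: "('o, 'm, 'z) moncat_scheme \<Rightarrow> 'm list \<Rightarrow> 'm" where
  "tensM_list V [] = Ident V (Unit V)"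
| "tensM_list V [f] = f"
| "tensM_list V (f # g # fs) = f \<otimes>\<^bsub>V\<^esub> tensM_list V (g # fs)"

text \<open>
  Mac Lane's coherence isomorphisms are not suppressed. The next two functions give the ones
  \<open>\<Otimes>(as @ bs) \<rightarrow> \<Otimes>as \<otimes> \<Otimes>bs\<close> and \<open>\<Otimes>\<^sub>i\<^sub>,\<^sub>j a\<^sub>i\<^sub>j \<rightarrow> \<Otimes>\<^sub>i \<Otimes>\<^sub>j a\<^sub>i\<^sub>j\<close>, in the latter of which
  empty inner lists contribute a factor \<open>I\<close> to the target only.
\<close>
fun split_iso :: "('o, 'm, 'z) moncat_scheme \<Rightarrow> 'o list \<Rightarrow> 'o list \<Rightarrow> 'm" where
  "split_iso V [] bs = inv_arr V (Lunit V (tensO_list V bs))"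
| "split_iso V [a] [] = inv_arr V (Runit V a)"
| "split_iso V [a] (b # bs) = Ident V (a \<otimes>\<^sub>o\<^bsub>V\<^esub> tensO_list V (b # bs))"
| "split_iso V (a # a' # as) bs =
     inv_arr V (Assoc V a (tensO_list V (a' # as)) (tensO_list V bs)) \<cdot>\<^bsub>V\<^esub>
     (Ident V a \<otimes>\<^bsub>V\<^esub> split_iso V (a' # as) bs)"

fun nest_iso :: "('o, 'm, 'z) moncat_scheme \<Rightarrow> 'o list list \<Rightarrow> 'm" where
  "nest_iso V [] = Ident V (Unit V)"
| "nest_iso V [as] = Ident V (tensO_list V as)"
| "nest_iso V (as # bs # ass) =
     (Ident V (tensO_list V as) \<otimes>\<^bsub>V\<^esub> nest_iso V (bs # ass)) \<cdot>\<^bsub>V\<^esub>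
     split_iso V as (concat (bs # ass))"


section \<open>Semigroups and monoids\<close>

text \<open>
  The data of an \<open>Oplax\<^sub>+\<close>-monoidal category: the product functors \<open>\<circ>\<^sub>n\<close> act on lists of length \<open>n\<close>,
  and the component of \<open>\<Psi>\<close> with indices \<open>k\<^sub>1, \<dots>, k\<^sub>n\<close> at a family of objects \<open>a\<^sub>i\<^sub>j\<close> is
  \<open>Psi [[a\<^sub>1\<^sub>1, \<dots>], \<dots>, [a\<^sub>n\<^sub>1, \<dots>]]\<close>, the indices being the lengths of the inner lists. In the
  \<open>Oplax\<^sub>+\<close> case all lists involved are nonempty.
\<close>
record ('o, 'm) oplax_data = "('o, 'm) cat" +
  ProdO :: "'o list \<Rightarrow> 'o"
  ProdM :: "'m list \<Rightarrow> 'm"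
  Psi :: "'o list list \<Rightarrow> 'm"
  Ups :: "'o \<Rightarrow> 'm"

text \<open>
  The data of a \<open>Lax\<^sub>0Oplax\<^sub>+\<close>-monoidal category: empty lists are allowed too, \<open>ProdO []\<close> being the
  nullary product, and there is a second family \<open>\<psi>\<close>, indexed in the same way as \<open>\<Psi>\<close>.
\<close>
record ('o, 'm) lax_oplax_data = "('o, 'm) oplax_data" +
  psi :: "'o list list \<Rightarrow> 'm"

definition is_semigroup :: "('o, 'm, 'z) oplax_data_scheme \<Rightarrow> 'o \<Rightarrow> 'm \<Rightarrow> bool" where
  "is_semigroup M a \<mu> \<longleftrightarrow>
     a \<in> Obj M \<and> \<mu> \<in> hom M (ProdO M [a, a]) a \<and>
     \<mu> \<cdot>\<^bsub>M\<^esub> ProdM M [\<mu>, Ups M a] \<cdot>\<^bsub>M\<^esub> Psi M [[a, a], [a]] =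
     \<mu> \<cdot>\<^bsub>M\<^esub> ProdM M [Ups M a, \<mu>] \<cdot>\<^bsub>M\<^esub> Psi M [[a], [a, a]]"

definition semigroup_cat ::
  "('o, 'm, 'z) oplax_data_scheme \<Rightarrow> ('o \<times> 'm, ('o \<times> 'm) \<times> 'm \<times> ('o \<times> 'm)) cat" where
  "semigroup_cat M =
     structured_cat M {(a, \<mu>). is_semigroup M a \<mu>} fst
       (\<lambda>(a, \<mu>) (a', \<mu>') f. f \<cdot>\<^bsub>M\<^esub> \<mu> = \<mu>' \<cdot>\<^bsub>M\<^esub> ProdM M [f, f])"

definition is_monoid :: "('o, 'm, 'z) lax_oplax_data_scheme \<Rightarrow> 'o \<Rightarrow> 'm \<Rightarrow> 'm \<Rightarrow> bool" where
  "is_monoid M a \<mu> \<eta> \<longleftrightarrow>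
     is_semigroup M a \<mu> \<and> \<eta> \<in> hom M (ProdO M []) a \<and>
     \<mu> \<cdot>\<^bsub>M\<^esub> ProdM M [\<eta>, Ident M a] = Ups M a \<cdot>\<^bsub>M\<^esub> psi M [[], [a]] \<and>
     \<mu> \<cdot>\<^bsub>M\<^esub> ProdM M [Ident M a, \<eta>] = Ups M a \<cdot>\<^bsub>M\<^esub> psi M [[a], []]"

definition monoid_cat ::
  "('o, 'm, 'z) lax_oplax_data_scheme \<Rightarrow>
     ('o \<times> 'm \<times> 'm, ('o \<times> 'm \<times> 'm) \<times> 'm \<times> ('o \<times> 'm \<times> 'm)) cat" where
  "monoid_cat M =
     structured_cat M {(a, \<mu>, \<eta>). is_monoid M a \<mu> \<eta>} fst
       (\<lambda>(a, \<mu>, \<eta>) (a', \<mu>', \<eta>') f.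
          f \<cdot>\<^bsub>M\<^esub> \<mu> = \<mu>' \<cdot>\<^bsub>M\<^esub> ProdM M [f, f] \<and> f \<cdot>\<^bsub>M\<^esub> \<eta> = \<eta>')"


section \<open>Objects with two commuting endomorphisms\<close>

type_synonym ('o, 'm) robj = "'o \<times> 'm \<times> 'm"
type_synonym ('o, 'm) rarr = "('o, 'm) robj \<times> 'm \<times> ('o, 'm) robj"

definition R_cat :: "('o, 'm, 'z) moncat_scheme \<Rightarrow> (('o, 'm) robj, ('o, 'm) rarr) cat" where
  "R_cat V =
     structured_cat V
       {(a, \<kappa>, \<nu>). a \<in> Obj V \<and> \<kappa> \<in> hom V a a \<and> \<nu> \<in> hom V a a \<and> \<kappa> \<cdot>\<^bsub>V\<^esub> \<nu> = \<nu> \<cdot>\<^bsub>V\<^esub> \<kappa>}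
       fst
       (\<lambda>(a, \<kappa>, \<nu>) (a', \<kappa>', \<nu>') \<theta>. \<theta> \<cdot>\<^bsub>V\<^esub> \<kappa> = \<kappa>' \<cdot>\<^bsub>V\<^esub> \<theta> \<and> \<theta> \<cdot>\<^bsub>V\<^esub> \<nu> = \<nu>' \<cdot>\<^bsub>V\<^esub> \<theta>)"

definition R_prodO :: "('o, 'm, 'z) moncat_scheme \<Rightarrow> ('o, 'm) robj list \<Rightarrow> ('o, 'm) robj" where
  "R_prodO V Xs =
     (tensO_list V (map (\<lambda>(a, \<kappa>, \<nu>). a) Xs),
      tensM_list V (map (\<lambda>(a, \<kappa>, \<nu>). \<kappa>) Xs),
      tensM_list V (map (\<lambda>(a, \<kappa>, \<nu>). \<nu>) Xs))"

definition R_prodM :: "('o, 'm, 'z) moncat_scheme \<Rightarrow> ('o, 'm) rarr list \<Rightarrow> ('o, 'm) rarr" where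
  "R_prodM V ts =
     (R_prodO V (map (\<lambda>(X, \<theta>, Y). X) ts),
      tensM_list V (map (\<lambda>(X, \<theta>, Y). \<theta>) ts),
      R_prodO V (map (\<lambda>(X, \<theta>, Y). Y) ts))"

definition Z :: "nat \<Rightarrow> nat" where
  "Z m = (if m = 0 then 1 else 0)"

definition bar :: "nat \<Rightarrow> nat" where
  "bar m = m + Z m"

text \<open>
  The endomorphism of \<open>\<Otimes>\<^sub>i \<Otimes>\<^sub>j a\<^sub>i\<^sub>j\<close> whose \<open>(i, j)\<close> factor is \<open>\<kappa>\<^sub>i\<^sub>j\<close> to the power
  \<open>\<Sum>p>i. e k\<^sub>p\<close> composed with \<open>\<nu>\<^sub>i\<^sub>j\<close> to the power \<open>\<Sum>p<i. e k\<^sub>p\<close> (with \<open>i\<close> counted from \<open>0\<close>).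
\<close>
definition R_endo ::
  "('o, 'm, 'z) moncat_scheme \<Rightarrow> (nat \<Rightarrow> nat) \<Rightarrow> ('o, 'm) robj list list \<Rightarrow> 'm" where
  "R_endo V e Xss =
     (let n = length Xss; k = (\<lambda>p. length (Xss ! p)) in
      tensM_list V
        (map (\<lambda>i. tensM_list V
            (map (\<lambda>(a, \<kappa>, \<nu>).
                arr_pow V \<kappa> (\<Sum>p \<in> {i<..<n}. e (k p)) \<cdot>\<^bsub>V\<^esub> arr_pow V \<nu> (\<Sum>p<i. e (k p)))
              (Xss ! i)))
          [0..<n]))"

definition insert_unit ::
  "('o, 'm, 'z) moncat_scheme \<Rightarrow> ('o, 'm) robj list \<Rightarrow> ('o, 'm) robj list" where
  "insert_unit V Xs = (if Xs = [] then [R_prodO V []] else Xs)"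

definition R_Psi :: "('o, 'm, 'z) moncat_scheme \<Rightarrow> ('o, 'm) robj list list \<Rightarrow> ('o, 'm) rarr" where
  "R_Psi V Xss =
     (R_prodO V (concat (map (insert_unit V) Xss)),
      R_endo V (\<lambda>k. bar k - 1) Xss \<cdot>\<^bsub>V\<^esub> nest_iso V (map (map fst \<circ> insert_unit V) Xss),
      R_prodO V (map (R_prodO V) Xss))"

definition R_psi :: "('o, 'm, 'z) moncat_scheme \<Rightarrow> ('o, 'm) robj list list \<Rightarrow> ('o, 'm) rarr" where
  "R_psi V Xss =
     (R_prodO V (concat (map (insert_unit V) Xss)),
      inv_arr V (nest_iso V (map (map fst) Xss)) \<cdot>\<^bsub>V\<^esub>
        (R_endo V Z Xss \<cdot>\<^bsub>V\<^esub> nest_iso V (map (map fst \<circ> insert_unit V) Xss)),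
      R_prodO V (concat Xss))"

text \<open>\<open>\<upsilon>\<close> is the identity, since \<open>\<circ>\<^sub>1\<close> is the identity functor.\<close>
definition R ::
  "('o, 'm, 'z) moncat_scheme \<Rightarrow> (('o, 'm) robj, ('o, 'm) rarr) lax_oplax_data" where
  "R V =
     \<lparr>Obj = Obj (R_cat V), Arr = Arr (R_cat V), Dom = Dom (R_cat V), Cod = Cod (R_cat V),
      Ident = Ident (R_cat V), Comp = Comp (R_cat V),
      ProdO = R_prodO V, ProdM = R_prodM V, Psi = R_Psi V, Ups = Ident (R_cat V),
      psi = R_psi V\<rparr>"


section \<open>BiHom-monoids\<close>

definition is_BiHom_monoid ::
  "('o, 'm, 'z) moncat_scheme \<Rightarrow> 'o \<Rightarrow> 'm \<Rightarrow> 'm \<Rightarrow> 'm \<Rightarrow> bool" where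
  "is_BiHom_monoid V a \<kappa> \<nu> \<mu> \<longleftrightarrow>
     a \<in> Obj V \<and> \<kappa> \<in> hom V a a \<and> \<nu> \<in> hom V a a \<and> \<mu> \<in> hom V (a \<otimes>\<^sub>o\<^bsub>V\<^esub> a) a \<and>
     \<kappa> \<cdot>\<^bsub>V\<^esub> \<nu> = \<nu> \<cdot>\<^bsub>V\<^esub> \<kappa> \<and>
     \<kappa> \<cdot>\<^bsub>V\<^esub> \<mu> = \<mu> \<cdot>\<^bsub>V\<^esub> (\<kappa> \<otimes>\<^bsub>V\<^esub> \<kappa>) \<and>
     \<nu> \<cdot>\<^bsub>V\<^esub> \<mu> = \<mu> \<cdot>\<^bsub>V\<^esub> (\<nu> \<otimes>\<^bsub>V\<^esub> \<nu>) \<and>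
     \<mu> \<cdot>\<^bsub>V\<^esub> (\<mu> \<otimes>\<^bsub>V\<^esub> Ident V a) \<cdot>\<^bsub>V\<^esub> ((Ident V a \<otimes>\<^bsub>V\<^esub> Ident V a) \<otimes>\<^bsub>V\<^esub> \<nu>) =
     \<mu> \<cdot>\<^bsub>V\<^esub> (Ident V a \<otimes>\<^bsub>V\<^esub> \<mu>) \<cdot>\<^bsub>V\<^esub> (\<kappa> \<otimes>\<^bsub>V\<^esub> (Ident V a \<otimes>\<^bsub>V\<^esub> Ident V a)) \<cdot>\<^bsub>V\<^esub> Assoc V a a a"

definition BiHom_monoid_cat ::
  "('o, 'm, 'z) moncat_scheme \<Rightarrow>
     ('o \<times> 'm \<times> 'm \<times> 'm, ('o \<times> 'm \<times> 'm \<times> 'm) \<times> 'm \<times> ('o \<times> 'm \<times> 'm \<times> 'm)) cat" where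
  "BiHom_monoid_cat V =
     structured_cat V {(a, \<kappa>, \<nu>, \<mu>). is_BiHom_monoid V a \<kappa> \<nu> \<mu>} fst
       (\<lambda>(a, \<kappa>, \<nu>, \<mu>) (a', \<kappa>', \<nu>', \<mu>') f.
          f \<cdot>\<^bsub>V\<^esub> \<kappa> = \<kappa>' \<cdot>\<^bsub>V\<^esub> f \<and> f \<cdot>\<^bsub>V\<^esub> \<nu> = \<nu>' \<cdot>\<^bsub>V\<^esub> f \<and>
          f \<cdot>\<^bsub>V\<^esub> \<mu> = \<mu>' \<cdot>\<^bsub>V\<^esub> (f \<otimes>\<^bsub>V\<^esub> f))"

definition is_unital_BiHom_monoid ::
  "('o, 'm, 'z) moncat_scheme \<Rightarrow> 'o \<Rightarrow> 'm \<Rightarrow> 'm \<Rightarrow> 'm \<Rightarrow> 'm \<Rightarrow> bool" where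
  "is_unital_BiHom_monoid V a \<kappa> \<nu> \<mu> \<eta> \<longleftrightarrow>
     is_BiHom_monoid V a \<kappa> \<nu> \<mu> \<and> \<eta> \<in> hom V (Unit V) a \<and>
     \<kappa> \<cdot>\<^bsub>V\<^esub> \<eta> = \<eta> \<and> \<nu> \<cdot>\<^bsub>V\<^esub> \<eta> = \<eta> \<and>
     \<mu> \<cdot>\<^bsub>V\<^esub> (\<eta> \<otimes>\<^bsub>V\<^esub> Ident V a) = \<nu> \<cdot>\<^bsub>V\<^esub> Lunit V a \<and>
     \<mu> \<cdot>\<^bsub>V\<^esub> (Ident V a \<otimes>\<^bsub>V\<^esub> \<eta>) = \<kappa> \<cdot>\<^bsub>V\<^esub> Runit V a"

definition unital_BiHom_monoid_cat ::
  "('o, 'm, 'z) moncat_scheme \<Rightarrow>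
     ('o \<times> 'm \<times> 'm \<times> 'm \<times> 'm,
      ('o \<times> 'm \<times> 'm \<times> 'm \<times> 'm) \<times> 'm \<times> ('o \<times> 'm \<times> 'm \<times> 'm \<times> 'm)) cat" where
  "unital_BiHom_monoid_cat V =
     structured_cat V {(a, \<kappa>, \<nu>, \<mu>, \<eta>). is_unital_BiHom_monoid V a \<kappa> \<nu> \<mu> \<eta>} fst
       (\<lambda>(a, \<kappa>, \<nu>, \<mu>, \<eta>) (a', \<kappa>', \<nu>', \<mu>', \<eta>') f.
          f \<cdot>\<^bsub>V\<^esub> \<kappa> = \<kappa>' \<cdot>\<^bsub>V\<^esub> f \<and> f \<cdot>\<^bsub>V\<^esub> \<nu> = \<nu>' \<cdot>\<^bsub>V\<^esub> f \<and>
          f \<cdot>\<^bsub>V\<^esub> \<mu> = \<mu>' \<cdot>\<^bsub>V\<^esub> (f \<otimes>\<^bsub>V\<^esub> f) \<and> f \<cdot>\<^bsub>V\<^esub> \<eta> = \<eta>')"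

end

theory Submission
  imports Defs
begin

text \<open>
  Only a few components of the coherence transformations of \<open>R V\<close> occur in the axioms of
  semigroups and monoids. At an object \<open>(a, \<kappa>, \<nu>)\<close> they are, up to the coherence isomorphisms
  of \<open>V\<close>, \<open>\<Psi>\<^sub>2\<^sub>,\<^sub>1 = 1 \<otimes> 1 \<otimes> \<nu>\<close>, \<open>\<Psi>\<^sub>1\<^sub>,\<^sub>2 = \<kappa> \<otimes> 1 \<otimes> 1\<close>, \<open>\<psi>\<^sub>0\<^sub>,\<^sub>1 = \<nu>\<close> and \<open>\<psi>\<^sub>1\<^sub>,\<^sub>0 = \<kappa>\<close>
  (\<open>R_Psi_2_1\<close>, \<open>R_Psi_1_2\<close>, \<open>R_psi_0_1\<close>, \<open>R_psi_1_0\<close>). Hence associativity in \<open>R V\<close> is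
  BiHom-associativity, and the unit laws in \<open>R V\<close> are \<open>\<mu>(\<eta> \<otimes> 1) = \<nu>\<close> and \<open>\<mu>(1 \<otimes> \<eta>) = \<kappa>\<close>. The
  remaining BiHom axioms say that \<open>\<kappa>\<close> and \<open>\<nu>\<close> commute, that is, that \<open>(a, \<kappa>, \<nu>)\<close> is an object of
  \<open>R V\<close>, and that \<open>\<mu>\<close> and \<open>\<eta>\<close> are arrows of \<open>R V\<close> from \<open>(a, \<kappa>, \<nu>) \<circ> (a, \<kappa>, \<nu>)\<close> and from
  \<open>(I, 1, 1)\<close>. So a semigroup or monoid in \<open>R V\<close> is the same data subject to the same equations as
  a BiHom-monoid or unital BiHom-monoid (\<open>is_semigroup_R_iff\<close>, \<open>is_monoid_R_iff\<close>).

  The same holds for their morphisms: an arrow of \<open>R V\<close> between given objects is an arrow of \<open>V\<close>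
  that commutes with the endomorphisms. The isomorphisms of categories therefore just rearrange
  tuples; \<open>isomorphic_structured_cat_R\<close> packages this, reducing what is to be shown to a bijection
  on objects and an equivalence of the conditions on arrows.
\<close>


section \<open>Isomorphisms of categories and of categories of structured objects\<close>

lemma isomorphic_categories_if_bij_functor:
  assumes F: "is_functor C D Fo Fa"
    and bo: "bij_betw Fo (Obj C) (Obj D)" and ba: "bij_betw Fa (Arr C) (Arr D)"
  shows "isomorphic_categories C D"
proof -
  interpret C: category C using F by (simp add: is_functor_def)
  interpret D: category D using F by (simp add: is_functor_def)
  define Go where "Go = inv_into (Obj C) Fo"
  define Ga where "Ga = inv_into (Arr C) Fa"
  have GFo: "Go (Fo a) = a" if "a \<in> Obj C" for a
    using bo that by (simp add: Go_def bij_betw_def inv_into_f_f)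
  have GFa: "Ga (Fa f) = f" if "f \<in> Arr C" for f
    using ba that by (simp add: Ga_def bij_betw_def inv_into_f_f)
  have Fo: "Fo a \<in> Obj D" if "a \<in> Obj C" for a
    using F that by (simp add: is_functor_def)
  have Fa: "Fa f \<in> hom D (Fo a) (Fo b)" if "f \<in> hom C a b" for f a b
    using F that unfolding is_functor_def by blast
  have FId: "Fa (Ident C a) = Ident D (Fo a)" if "a \<in> Obj C" for a
    using F that by (simp add: is_functor_def)
  have FComp: "Fa (g \<cdot>\<^bsub>C\<^esub> f) = Fa g \<cdot>\<^bsub>D\<^esub> Fa f" if "f \<in> hom C a b" "g \<in> hom C b c" for f g a b c
    using F that unfolding is_functor_def by blast
  have onto_obj: "\<exists>a \<in> Obj C. b = Fo a" if "b \<in> Obj D" for b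
    using bo that by (auto simp: bij_betw_def)
  have onto_hom: "\<exists>f a b. f \<in> hom C a b \<and> a \<in> Obj C \<and> b \<in> Obj C \<and> g = Fa f \<and> x = Fo a \<and> y = Fo b"
    if g: "g \<in> hom D x y" for g x y
  proof -
    obtain f where f: "f \<in> Arr C" "g = Fa f"
      using ba g by (auto simp: bij_betw_def hom_def)
    then have "f \<in> hom C (Dom C f) (Cod C f)" by (simp add: hom_def)
    moreover from this have "x = Fo (Dom C f)" "y = Fo (Cod C f)"
      using Fa[of f] g f by (auto simp: hom_def)
    ultimately show ?thesis using f C.Dom_Obj C.Cod_Obj by blast
  qed
  \<comment> \<open>The inverse maps form a functor because \<open>Fa\<close> reflects domains and codomains: \<open>Fo\<close> is
     injective on objects.\<close>
  have G: "is_functor D C Go Ga"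
    unfolding is_functor_def
  proof (intro conjI allI ballI)
    show "category D" "category C" by (rule D.category_axioms C.category_axioms)+
    show "Go b \<in> Obj C" if "b \<in> Obj D" for b
      using onto_obj[OF that] GFo by auto
    show "Ga g \<in> hom C (Go x) (Go y)" if "g \<in> hom D x y" for x y g
      using onto_hom[OF that] GFo GFa by (auto simp: hom_def)
    show "Ga (Ident D b) = Ident C (Go b)" if b: "b \<in> Obj D" for b
    proof -
      obtain a where a: "a \<in> Obj C" "b = Fo a" using onto_obj[OF b] by blast
      then have "Ident C a \<in> Arr C" using C.Ident_hom by (simp add: hom_def)
      then show ?thesis using a GFo GFa FId by metis
    qed
    show "Ga (g \<cdot>\<^bsub>D\<^esub> f) = Ga g \<cdot>\<^bsub>C\<^esub> Ga f" if fg: "f \<in> hom D x y" "g \<in> hom D y z" for x y z f g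
    proof -
      obtain f' a b where f': "f' \<in> hom C a b" "b \<in> Obj C" "f = Fa f'" "y = Fo b"
        using onto_hom[OF fg(1)] by blast
      obtain g' b' c where g': "g' \<in> hom C b' c" "b' \<in> Obj C" "g = Fa g'" "y = Fo b'"
        using onto_hom[OF fg(2)] by blast
      have "b' = b" using GFo f' g' by metis
      then have c: "g' \<cdot>\<^bsub>C\<^esub> f' \<in> hom C a c" and "g \<cdot>\<^bsub>D\<^esub> f = Fa (g' \<cdot>\<^bsub>C\<^esub> f')"
        using f' g' C.Comp_hom FComp by auto
      then have "Ga (g \<cdot>\<^bsub>D\<^esub> f) = g' \<cdot>\<^bsub>C\<^esub> f'" using GFa by (simp add: hom_def)
      then show ?thesis using GFa f' g' by (simp add: hom_def)
    qed
  qed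
  have "\<forall>b \<in> Obj D. Fo (Go b) = b" using onto_obj GFo by force
  moreover have "\<forall>g \<in> Arr D. Fa (Ga g) = g"
    using ba by (simp add: Ga_def bij_betw_def f_inv_into_f)
  ultimately show ?thesis
    unfolding isomorphic_categories_def using F G GFo GFa by blast
qed

lemma structured_cat_hom:
  "t \<in> hom (structured_cat C S U P) X Y \<longleftrightarrow>
     (\<exists>f. t = (X, f, Y) \<and> X \<in> S \<and> Y \<in> S \<and> f \<in> hom C (U X) (U Y) \<and> P X Y f)"
  by (auto simp: structured_cat_def hom_def)

lemma structured_cat_Comp [simp]:
  "(Y', g, W) \<cdot>\<^bsub>structured_cat C S U P\<^esub> (X, f, Y) = (X, g \<cdot>\<^bsub>C\<^esub> f, W)"
  by (simp add: structured_cat_def)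

lemma structured_cat_Obj [simp]: "Obj (structured_cat C S U P) = S"
  by (simp add: structured_cat_def)

lemma structured_cat_Ident [simp]:
  "Ident (structured_cat C S U P) X = (X, Ident C (U X), X)"
  by (simp add: structured_cat_def)

lemma category_structured_cat:
  assumes "category C"
    and U: "\<And>X. X \<in> S \<Longrightarrow> U X \<in> Obj C"
    and P_Ident: "\<And>X. X \<in> S \<Longrightarrow> P X X (Ident C (U X))"
    and P_Comp: "\<And>X Y Z f g. \<lbrakk>X \<in> S; Y \<in> S; Z \<in> S; f \<in> hom C (U X) (U Y); g \<in> hom C (U Y) (U Z);
        P X Y f; P Y Z g\<rbrakk> \<Longrightarrow> P X Z (g \<cdot>\<^bsub>C\<^esub> f)"
  shows "category (structured_cat C S U P)"
proof -
  interpret category C by fact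
  let ?S = "structured_cat C S U P"
  show ?thesis
  proof
    show "Dom ?S f \<in> Obj ?S" "Cod ?S f \<in> Obj ?S" if "f \<in> Arr ?S" for f
      using that by (auto simp: structured_cat_def)
    show "Ident ?S X \<in> hom ?S X X" if "X \<in> Obj ?S" for X
      using that by (simp add: structured_cat_hom Ident_hom U P_Ident)
    show "g \<cdot>\<^bsub>?S\<^esub> f \<in> hom ?S X Z" if "f \<in> hom ?S X Y" "g \<in> hom ?S Y Z" for f g X Y Z
      using that by (auto simp: structured_cat_hom intro: Comp_hom P_Comp)
    show "f \<cdot>\<^bsub>?S\<^esub> Ident ?S X = f" "Ident ?S Y \<cdot>\<^bsub>?S\<^esub> f = f" if "f \<in> hom ?S X Y" for f X Y
      using that by (auto simp: structured_cat_hom Comp_Ident_right Comp_Ident_left)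
    show "(h \<cdot>\<^bsub>?S\<^esub> g) \<cdot>\<^bsub>?S\<^esub> f = h \<cdot>\<^bsub>?S\<^esub> (g \<cdot>\<^bsub>?S\<^esub> f)"
      if "f \<in> hom ?S W X" "g \<in> hom ?S X Y" "h \<in> hom ?S Y Z" for f g h W X Y Z
      using that by (auto simp: structured_cat_hom Comp_assoc)
  qed
qed


text \<open>Pasting of two adjacent commutative squares.\<close>
lemma (in category) square_Comp:
  assumes f: "f \<in> hom C a b" and g: "g \<in> hom C b c"
    and f': "f' \<in> hom C a' b'" and g': "g' \<in> hom C b' c'"
    and x: "x \<in> hom C a a'" and y: "y \<in> hom C b b'" and z: "z \<in> hom C c c'"
    and fx: "f' \<cdot> x = y \<cdot> f" and gy: "g' \<cdot> y = z \<cdot> g"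
  shows "(g' \<cdot> f') \<cdot> x = z \<cdot> (g \<cdot> f)"
proof -
  have "(g' \<cdot> f') \<cdot> x = g' \<cdot> (y \<cdot> f)" using Comp_assoc[OF x f' g'] fx by simp
  also have "\<dots> = (z \<cdot> g) \<cdot> f" using Comp_assoc[OF f y g'] gy by simp
  also have "\<dots> = z \<cdot> (g \<cdot> f)" by (rule Comp_assoc[OF f g z])
  finally show ?thesis .
qed


section \<open>Structured objects over the category of pairs of commuting endomorphisms\<close>

lemma R_simps [simp]:
  "ProdO (R V) = R_prodO V" "ProdM (R V) = R_prodM V" "Psi (R V) = R_Psi V"
  "psi (R V) = R_psi V"
  "Ups (R V) (a, \<kappa>, \<nu>) = ((a, \<kappa>, \<nu>), Ident V a, (a, \<kappa>, \<nu>))"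
  "Ident (R V) (a, \<kappa>, \<nu>) = ((a, \<kappa>, \<nu>), Ident V a, (a, \<kappa>, \<nu>))"
  "(B', g, C) \<cdot>\<^bsub>R V\<^esub> (A, f, B) = (A, g \<cdot>\<^bsub>V\<^esub> f, C)"
  by (simp_all add: R_def R_cat_def)

lemma R_Obj:
  "(a, \<kappa>, \<nu>) \<in> Obj (R V) \<longleftrightarrow>
     a \<in> Obj V \<and> \<kappa> \<in> hom V a a \<and> \<nu> \<in> hom V a a \<and> \<kappa> \<cdot>\<^bsub>V\<^esub> \<nu> = \<nu> \<cdot>\<^bsub>V\<^esub> \<kappa>"
  by (simp add: R_def R_cat_def)

lemma R_hom:
  "t \<in> hom (R V) (a, \<kappa>, \<nu>) (a', \<kappa>', \<nu>') \<longleftrightarrow>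
     (\<exists>\<theta>. t = ((a, \<kappa>, \<nu>), \<theta>, (a', \<kappa>', \<nu>')) \<and>
        (a, \<kappa>, \<nu>) \<in> Obj (R V) \<and> (a', \<kappa>', \<nu>') \<in> Obj (R V) \<and> \<theta> \<in> hom V a a' \<and>
        \<theta> \<cdot>\<^bsub>V\<^esub> \<kappa> = \<kappa>' \<cdot>\<^bsub>V\<^esub> \<theta> \<and> \<theta> \<cdot>\<^bsub>V\<^esub> \<nu> = \<nu>' \<cdot>\<^bsub>V\<^esub> \<theta>)"
proof -
  have "hom (R V) X Y = hom (R_cat V) X Y" "Obj (R V) = Obj (R_cat V)" for X Y
    by (auto simp: hom_def R_def)
  then show ?thesis by (auto simp: R_cat_def structured_cat_hom)
qed

lemma category_R:
  assumes "category V"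
  shows "category (R V)"
proof -
  interpret category V by fact
  have "category (R_cat V)"
    unfolding R_cat_def
  proof (rule category_structured_cat[OF assms], goal_cases)
    case (3 X Y Z f g)
    note square = square_Comp[OF 3(4,5,4,5)]
    show ?case using 3 by (auto intro: square)
  qed (auto simp: Comp_Ident_left Comp_Ident_right)
  then show ?thesis
    unfolding category_def R_def hom_def by simp
qed

text \<open>
  Structured objects over \<open>R V\<close> may be described over \<open>V\<close>, by recording the two endomorphisms as
  part of the structure and requiring arrows to commute with them. Here \<open>Fo\<close> translates
  structured objects over \<open>R V\<close> into structured objects over \<open>V\<close>; on arrows the isomorphism keeps
  the middle component \<open>\<theta>\<close> of the triple that is an arrow of \<open>R V\<close>. Closure of the arrows under
  identities and composition need only be known over \<open>V\<close>, as the assumption \<open>PQ\<close> transfers it.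
\<close>
lemma isomorphic_structured_cat_R:
  assumes V: "category V"
    and U: "\<And>X. X \<in> S \<Longrightarrow> U X \<in> Obj (R V)"
    and Fo: "bij_betw Fo S T"
    and W: "\<And>X. X \<in> S \<Longrightarrow> W (Fo X) = fst (U X)"
    and PQ: "\<And>X Y \<theta>. \<lbrakk>X \<in> S; Y \<in> S; \<theta> \<in> hom V (W (Fo X)) (W (Fo Y))\<rbrakk> \<Longrightarrow>
      Q (Fo X) (Fo Y) \<theta> \<longleftrightarrow> (U X, \<theta>, U Y) \<in> hom (R V) (U X) (U Y) \<and> P X Y (U X, \<theta>, U Y)"
    and Q_Ident: "\<And>X. X \<in> T \<Longrightarrow> Q X X (Ident V (W X))"
    and Q_Comp: "\<And>X Y Z f g. \<lbrakk>X \<in> T; Y \<in> T; Z \<in> T; f \<in> hom V (W X) (W Y);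
      g \<in> hom V (W Y) (W Z); Q X Y f; Q Y Z g\<rbrakk> \<Longrightarrow> Q X Z (g \<cdot>\<^bsub>V\<^esub> f)"
  shows "isomorphic_categories (structured_cat (R V) S U P) (structured_cat V T W Q)"
proof -
  interpret category V by fact
  have T: "T = Fo ` S" and inj: "inj_on Fo S" using Fo by (auto simp: bij_betw_def)
  have hom_R: "\<exists>\<theta>. t = (U X, \<theta>, U Y) \<and> \<theta> \<in> hom V (W (Fo X)) (W (Fo Y))"
    if "X \<in> S" "Y \<in> S" "t \<in> hom (R V) (U X) (U Y)" for X Y t
    using that(3) W[OF that(1)] W[OF that(2)] by (cases "U X"; cases "U Y") (auto simp: R_hom)
  have Ident_R: "Ident (R V) (U X) = (U X, Ident V (W (Fo X)), U X)" if "X \<in> S" for X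
    using W[OF that] by (cases "U X") auto
  have W_Obj: "W (Fo X) \<in> Obj V" if "X \<in> S" for X
    using U[OF that] W[OF that] by (cases "U X") (auto simp: R_Obj)
  have D: "category (structured_cat V T W Q)"
    using W_Obj Q_Ident Q_Comp by (intro category_structured_cat V) (auto simp: T)
  have C: "category (structured_cat (R V) S U P)"
  proof (rule category_structured_cat[OF category_R[OF V] U], goal_cases)
    case (2 X)
    then show ?case
      using PQ[of X X "Ident V (W (Fo X))"] Q_Ident[of "Fo X"] Ident_hom W_Obj
      by (simp add: T Ident_R)
  next
    case (3 X Y Z f g)
    obtain \<phi> where f: "f = (U X, \<phi>, U Y)" "\<phi> \<in> hom V (W (Fo X)) (W (Fo Y))"
      using hom_R 3 by blast
    obtain \<gamma> where g: "g = (U Y, \<gamma>, U Z)" "\<gamma> \<in> hom V (W (Fo Y)) (W (Fo Z))"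
      using hom_R 3 by blast
    have "Q (Fo X) (Fo Y) \<phi>" "Q (Fo Y) (Fo Z) \<gamma>" using PQ 3 f g by auto
    then have "Q (Fo X) (Fo Z) (\<gamma> \<cdot>\<^bsub>V\<^esub> \<phi>)" using Q_Comp[of "Fo X" "Fo Y" "Fo Z"] f g 3 by (simp add: T)
    then show ?case
      using PQ[OF 3(1,3) Comp_hom[OF f(2) g(2)]] f g by simp
  qed
  define Fa where "Fa = (\<lambda>(X, (A :: ('a, 'b) robj, \<theta>, B :: ('a, 'b) robj), Y). (Fo X, \<theta> :: 'b, Fo Y))"
  have "is_functor (structured_cat (R V) S U P) (structured_cat V T W Q) Fo Fa"
    unfolding is_functor_def
  proof (intro conjI allI ballI C D, goal_cases)
    case (1 X)
    then show ?case by (simp add: T)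
  next
    case (2 X Y f)
    then obtain t where t: "f = (X, t, Y)" "X \<in> S" "Y \<in> S" "t \<in> hom (R V) (U X) (U Y)" "P X Y t"
      by (auto simp: structured_cat_hom)
    then obtain \<theta> where "t = (U X, \<theta>, U Y)" "\<theta> \<in> hom V (W (Fo X)) (W (Fo Y))"
      using hom_R by blast
    then show ?case using t PQ[of X Y \<theta>] by (auto simp: structured_cat_hom Fa_def T)
  next
    case (3 X)
    then show ?case by (simp add: Ident_R Fa_def)
  next
    case (4 X Y Z f g)
    then show ?case by (auto simp: structured_cat_hom Fa_def dest!: hom_R)
  qed
  moreover have "bij_betw Fa (Arr (structured_cat (R V) S U P)) (Arr (structured_cat V T W Q))"
    (is "bij_betw Fa ?A ?B")
  proof (rule bij_betwI')
    have A: "\<exists>X Y \<theta>. f = (X, (U X, \<theta>, U Y), Y) \<and> X \<in> S \<and> Y \<in> S \<and> Q (Fo X) (Fo Y) \<theta> \<and>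
        \<theta> \<in> hom V (W (Fo X)) (W (Fo Y))" if f: "f \<in> ?A" for f
    proof -
      obtain X t Y where t: "f = (X, t, Y)" "X \<in> S" "Y \<in> S" "t \<in> hom (R V) (U X) (U Y)" "P X Y t"
        using f by (auto simp: structured_cat_def)
      then show ?thesis using hom_R[OF t(2,3,4)] PQ[of X Y] by blast
    qed
    show "Fa f = Fa g \<longleftrightarrow> f = g" if "f \<in> ?A" "g \<in> ?A" for f g
      using A[OF that(1)] A[OF that(2)] inj by (auto simp: Fa_def inj_on_def)
    show "Fa f \<in> ?B" if "f \<in> ?A" for f
      using A[OF that] by (auto simp: Fa_def structured_cat_def T)
    show "\<exists>f \<in> ?A. g = Fa f" if g: "g \<in> ?B" for g
    proof -
      obtain X Y \<theta> where g': "g = (Fo X, \<theta>, Fo Y)" "X \<in> S" "Y \<in> S"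
          "\<theta> \<in> hom V (W (Fo X)) (W (Fo Y))" "Q (Fo X) (Fo Y) \<theta>"
        using g by (auto simp: structured_cat_def T)
      then have "(X, (U X, \<theta>, U Y), Y) \<in> ?A"
        using PQ[of X Y \<theta>] by (simp add: structured_cat_def)
      moreover have "g = Fa (X, (U X, \<theta>, U Y), Y)" using g' by (simp add: Fa_def)
      ultimately show ?thesis by blast
    qed
  qed
  ultimately show ?thesis
    using Fo isomorphic_categories_if_bij_functor by fastforce
qed


section \<open>The coherence transformations in low degrees\<close>

lemma (in category) inv_arr_eq:
  assumes "inverse_arrows C f g"
  shows "inv_arr C f = g"
  unfolding inv_arr_def
proof (rule the_equality)
  show "inverse_arrows C f g" by fact
  fix h assume "inverse_arrows C f h"
  then obtain a b where h: "f \<in> hom C a b" "h \<in> hom C b a" "h \<cdot> f = Ident C a" "f \<cdot> h = Ident C b"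
    unfolding inverse_arrows_def by blast
  have g: "g \<in> hom C b a" "g \<cdot> f = Ident C a" "f \<cdot> g = Ident C b"
    using assms h(1) by (auto simp: inverse_arrows_def hom_def)
  have "h = h \<cdot> (f \<cdot> g)" using h g Comp_Ident_right by metis
  also have "\<dots> = (h \<cdot> f) \<cdot> g" using h g Comp_assoc by metis
  also have "\<dots> = g" using h g Comp_Ident_left by metis
  finally show "h = g" .
qed

lemma (in category) inverse_arrows_inv_arr:
  assumes "iso_arr C f"
  shows "inverse_arrows C f (inv_arr C f)"
  using assms inv_arr_eq by (auto simp: iso_arr_def)

lemma (in category) inv_arr_hom:
  assumes "iso_arr C f" "f \<in> hom C a b"
  shows "inv_arr C f \<in> hom C b a" "inv_arr C f \<cdot> f = Ident C a" "f \<cdot> inv_arr C f = Ident C b"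
  using inverse_arrows_inv_arr[OF assms(1)] assms(2) by (auto simp: inverse_arrows_def hom_def)

lemma (in category) inv_arr_inv_arr:
  assumes "iso_arr C f"
  shows "inv_arr C (inv_arr C f) = f"
  using inverse_arrows_inv_arr[OF assms] by (intro inv_arr_eq) (auto simp: inverse_arrows_def)

lemma hom_Dom: "f \<in> hom C a b \<Longrightarrow> Dom C f = a"
  by (simp add: hom_def)

text \<open>The range \<open>p > i\<close> of the exponent of \<open>\<kappa>\<close> for \<open>n = 2\<close> and \<open>i = 0\<close>.\<close>
lemma interval_01: "{0<..<Suc (Suc 0)} = {Suc 0}"
  by auto

context monoidal_category
begin

lemmas id_simps = Ident_hom Comp_Ident_left Comp_Ident_right TensM_Ident TensO_Obj Unit_Obj

context
  fixes a \<kappa> \<nu>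
  assumes A: "(a, \<kappa>, \<nu>) \<in> Obj (R V)"
begin

private lemma a: "a \<in> Obj V" and \<kappa>: "\<kappa> \<in> hom V a a" and \<nu>: "\<nu> \<in> hom V a a"
  using A by (auto simp: R_Obj)

private lemmas facts = a \<kappa> \<nu> hom_Dom[OF \<kappa>] hom_Dom[OF \<nu>]
  Comp_Ident_left[OF \<kappa>] Comp_Ident_left[OF \<nu>] Comp_Ident_right[OF \<kappa>] Comp_Ident_right[OF \<nu>]
  Comp_Ident_left[OF Ident_hom] Comp_Ident_right[OF Ident_hom]

text \<open>
  The inverse associator arises from \<open>nest_iso\<close>: the source is bracketed to the right, whereas the
  factors of the target are \<open>a \<otimes> a\<close> and \<open>a\<close>.
\<close>
lemma R_Psi_2_1:
  "R_Psi V [[(a, \<kappa>, \<nu>), (a, \<kappa>, \<nu>)], [(a, \<kappa>, \<nu>)]] =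
     (R_prodO V [(a, \<kappa>, \<nu>), (a, \<kappa>, \<nu>), (a, \<kappa>, \<nu>)],
      ((Ident V a \<otimes> Ident V a) \<otimes> \<nu>) \<cdot> inv_arr V (Assoc V a a a),
      R_prodO V [R_prodO V [(a, \<kappa>, \<nu>), (a, \<kappa>, \<nu>)], (a, \<kappa>, \<nu>)])"
proof -
  have i: "inv_arr V (Assoc V a a a) \<in> hom V (a \<otimes>\<^sub>o a \<otimes>\<^sub>o a) ((a \<otimes>\<^sub>o a) \<otimes>\<^sub>o a)"
    using inv_arr_hom(1)[OF Assoc_iso Assoc_hom] a by simp
  show ?thesis
    using i
    by (simp add: R_Psi_def R_endo_def bar_def Z_def Let_def insert_unit_def R_prodO_def
        facts id_simps)
qed

text \<open>Here both sides are bracketed to the right, so \<open>nest_iso\<close> is an identity.\<close>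
lemma R_Psi_1_2:
  "R_Psi V [[(a, \<kappa>, \<nu>)], [(a, \<kappa>, \<nu>), (a, \<kappa>, \<nu>)]] =
     (R_prodO V [(a, \<kappa>, \<nu>), (a, \<kappa>, \<nu>), (a, \<kappa>, \<nu>)],
      \<kappa> \<otimes> (Ident V a \<otimes> Ident V a),
      R_prodO V [(a, \<kappa>, \<nu>), R_prodO V [(a, \<kappa>, \<nu>), (a, \<kappa>, \<nu>)]])"
proof -
  have "\<kappa> \<otimes> Ident V (a \<otimes>\<^sub>o a) \<in> hom V (a \<otimes>\<^sub>o a \<otimes>\<^sub>o a) (a \<otimes>\<^sub>o a \<otimes>\<^sub>o a)"
    using TensM_hom \<kappa> Ident_hom TensO_Obj a by simp
  then show ?thesis
    by (simp add: R_Psi_def R_endo_def bar_def Z_def Let_def insert_unit_def R_prodO_def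
        facts id_simps interval_01)
qed

text \<open>
  When an inner list is empty, \<open>nest_iso\<close> inserts a unit and so is the inverse of a unit
  isomorphism. Inverted in \<open>\<psi>\<close>, it becomes that unit isomorphism, and naturality moves it past the
  endomorphism.
\<close>
lemma R_psi_0_1:
  "R_psi V [[], [(a, \<kappa>, \<nu>)]] =
     (R_prodO V [R_prodO V [], (a, \<kappa>, \<nu>)], \<nu> \<cdot> Lunit V a, (a, \<kappa>, \<nu>))"
proof -
  have i: "inv_arr V (Lunit V a) \<in> hom V a (Unit V \<otimes>\<^sub>o a)"
    using inv_arr_hom(1)[OF Lunit_iso Lunit_hom] a by simp
  have "Ident V (Unit V) \<otimes> \<nu> \<in> hom V (Unit V \<otimes>\<^sub>o a) (Unit V \<otimes>\<^sub>o a)"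
    using TensM_hom \<nu> Ident_hom Unit_Obj by simp
  then show ?thesis
    using i
    by (simp add: R_psi_def R_endo_def Z_def Let_def insert_unit_def R_prodO_def
        facts id_simps interval_01 inv_arr_inv_arr Lunit_iso Lunit_natural)
qed

lemma R_psi_1_0:
  "R_psi V [[(a, \<kappa>, \<nu>)], []] =
     (R_prodO V [(a, \<kappa>, \<nu>), R_prodO V []], \<kappa> \<cdot> Runit V a, (a, \<kappa>, \<nu>))"
proof -
  have i: "inv_arr V (Runit V a) \<in> hom V a (a \<otimes>\<^sub>o Unit V)"
    using inv_arr_hom(1)[OF Runit_iso Runit_hom] a by simp
  have "\<kappa> \<otimes> Ident V (Unit V) \<in> hom V (a \<otimes>\<^sub>o Unit V) (a \<otimes>\<^sub>o Unit V)"
    using TensM_hom \<kappa> Ident_hom Unit_Obj by simp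
  then show ?thesis
    using i
    by (simp add: R_psi_def R_endo_def Z_def Let_def insert_unit_def R_prodO_def
        facts id_simps interval_01 inv_arr_inv_arr Runit_iso Runit_natural)
qed

lemma R_prodO_2_Obj: "R_prodO V [(a, \<kappa>, \<nu>), (a, \<kappa>, \<nu>)] \<in> Obj (R V)"
  using A TensM_hom[OF \<kappa> \<kappa>] TensM_hom[OF \<nu> \<nu>] TensO_Obj
    TensM_Comp[OF \<kappa> \<nu> \<kappa> \<nu>] TensM_Comp[OF \<nu> \<kappa> \<nu> \<kappa>]
  by (simp add: R_prodO_def R_Obj)

end

lemma R_prodO_0_Obj: "R_prodO V [] \<in> Obj (R V)"
  by (simp add: R_prodO_def R_Obj id_simps)

text \<open>
  The two sides of the associativity condition in \<open>R V\<close> are those of the BiHom-associativity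
  condition preceded by the inverse of the associator.
\<close>
lemma is_semigroup_R_iff:
  "is_semigroup (R V) (a, \<kappa>, \<nu>) m \<longleftrightarrow>
     (\<exists>\<mu>. m = (R_prodO V [(a, \<kappa>, \<nu>), (a, \<kappa>, \<nu>)], \<mu>, (a, \<kappa>, \<nu>)) \<and> is_BiHom_monoid V a \<kappa> \<nu> \<mu>)"
proof (cases "(a, \<kappa>, \<nu>) \<in> Obj (R V)")
  case False
  then show ?thesis by (auto simp: is_semigroup_def is_BiHom_monoid_def R_Obj)
next
  case A: True
  let ?A = "(a, \<kappa>, \<nu>)" and ?\<alpha> = "Assoc V a a a" and ?i = "Ident V a"
  have a: "a \<in> Obj V" and \<kappa>: "\<kappa> \<in> hom V a a" and \<nu>: "\<nu> \<in> hom V a a" using A by (auto simp: R_Obj)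
  note i = Ident_hom[OF a]
  have \<alpha>: "?\<alpha> \<in> hom V ((a \<otimes>\<^sub>o a) \<otimes>\<^sub>o a) (a \<otimes>\<^sub>o a \<otimes>\<^sub>o a)" using Assoc_hom a by simp
  note inv = inv_arr_hom[OF Assoc_iso[OF a a a] \<alpha>]
  have assoc: "\<mu> \<cdot> (\<mu> \<otimes> ?i) \<cdot> (((?i \<otimes> ?i) \<otimes> \<nu>) \<cdot> inv_arr V ?\<alpha>) =
        \<mu> \<cdot> (?i \<otimes> \<mu>) \<cdot> (\<kappa> \<otimes> (?i \<otimes> ?i)) \<longleftrightarrow>
      \<mu> \<cdot> (\<mu> \<otimes> ?i) \<cdot> ((?i \<otimes> ?i) \<otimes> \<nu>) = \<mu> \<cdot> (?i \<otimes> \<mu>) \<cdot> (\<kappa> \<otimes> (?i \<otimes> ?i)) \<cdot> ?\<alpha>"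
    if \<mu>: "\<mu> \<in> hom V (a \<otimes>\<^sub>o a) a" for \<mu>
  proof -
    define l where "l = \<mu> \<cdot> (\<mu> \<otimes> ?i)"
    define n where "n = (?i \<otimes> ?i) \<otimes> \<nu>"
    define r where "r = \<mu> \<cdot> (?i \<otimes> \<mu>) \<cdot> (\<kappa> \<otimes> (?i \<otimes> ?i))"
    have l: "l \<in> hom V ((a \<otimes>\<^sub>o a) \<otimes>\<^sub>o a) a"
      unfolding l_def by (rule Comp_hom TensM_hom \<mu> i)+
    have n: "n \<in> hom V ((a \<otimes>\<^sub>o a) \<otimes>\<^sub>o a) ((a \<otimes>\<^sub>o a) \<otimes>\<^sub>o a)"
      unfolding n_def by (rule TensM_hom \<nu> i)+
    have r: "r \<in> hom V (a \<otimes>\<^sub>o a \<otimes>\<^sub>o a) a"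
      unfolding r_def by (rule Comp_hom TensM_hom \<mu> i \<kappa>)+
    have "l \<cdot> (n \<cdot> inv_arr V ?\<alpha>) = r \<longleftrightarrow> l \<cdot> n = r \<cdot> ?\<alpha>"
    proof
      assume "l \<cdot> (n \<cdot> inv_arr V ?\<alpha>) = r"
      then have "r \<cdot> ?\<alpha> = ((l \<cdot> n) \<cdot> inv_arr V ?\<alpha>) \<cdot> ?\<alpha>"
        using Comp_assoc[OF inv(1) n l] by simp
      also have "\<dots> = l \<cdot> n"
        using Comp_assoc[OF \<alpha> inv(1) Comp_hom[OF n l]] inv(2) Comp_Ident_right Comp_hom[OF n l]
        by simp
      finally show "l \<cdot> n = r \<cdot> ?\<alpha>" by simp
    next
      assume "l \<cdot> n = r \<cdot> ?\<alpha>"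
      then have "l \<cdot> (n \<cdot> inv_arr V ?\<alpha>) = (r \<cdot> ?\<alpha>) \<cdot> inv_arr V ?\<alpha>"
        using Comp_assoc[OF inv(1) n l] by simp
      also have "\<dots> = r" using Comp_assoc[OF inv(1) \<alpha> r] inv(3) Comp_Ident_right r by simp
      finally show "l \<cdot> (n \<cdot> inv_arr V ?\<alpha>) = r" .
    qed
    then show ?thesis by (simp add: l_def n_def r_def)
  qed
  have hom: "m \<in> hom (R V) (R_prodO V [?A, ?A]) ?A \<longleftrightarrow>
      (\<exists>\<mu>. m = (R_prodO V [?A, ?A], \<mu>, ?A) \<and> \<mu> \<in> hom V (a \<otimes>\<^sub>o a) a \<and>
        \<kappa> \<cdot> \<mu> = \<mu> \<cdot> (\<kappa> \<otimes> \<kappa>) \<and> \<nu> \<cdot> \<mu> = \<mu> \<cdot> (\<nu> \<otimes> \<nu>))"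
    using A R_prodO_2_Obj[OF A] by (auto simp: R_prodO_def R_hom)
  have *: "is_semigroup (R V) ?A (R_prodO V [?A, ?A], \<mu>, ?A) \<longleftrightarrow> is_BiHom_monoid V a \<kappa> \<nu> \<mu>"
    if "(R_prodO V [?A, ?A], \<mu>, ?A) \<in> hom (R V) (R_prodO V [?A, ?A]) ?A" for \<mu>
  proof -
    have "\<mu> \<in> hom V (a \<otimes>\<^sub>o a) a" "\<kappa> \<cdot> \<mu> = \<mu> \<cdot> (\<kappa> \<otimes> \<kappa>)" "\<nu> \<cdot> \<mu> = \<mu> \<cdot> (\<nu> \<otimes> \<nu>)"
      using that A by (auto simp: R_prodO_def R_hom)
    then show ?thesis
      using that A assoc[of \<mu>]
      by (simp add: is_semigroup_def is_BiHom_monoid_def R_Psi_2_1[OF A] R_Psi_1_2[OF A] R_prodM_def)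
        (simp add: R_Obj)
  qed
  show ?thesis
  proof
    assume s: "is_semigroup (R V) ?A m"
    then show "\<exists>\<mu>. m = (R_prodO V [?A, ?A], \<mu>, ?A) \<and> is_BiHom_monoid V a \<kappa> \<nu> \<mu>"
      using hom * by (auto simp: is_semigroup_def)
  next
    assume "\<exists>\<mu>. m = (R_prodO V [?A, ?A], \<mu>, ?A) \<and> is_BiHom_monoid V a \<kappa> \<nu> \<mu>"
    then show "is_semigroup (R V) ?A m"
      using hom * unfolding is_BiHom_monoid_def by blast
  qed
qed

text \<open>
  As \<open>\<circ>\<^sub>0\<close> carries identity endomorphisms, that \<open>\<eta>\<close> is an arrow of \<open>R V\<close> means
  \<open>\<kappa>\<eta> = \<eta> = \<nu>\<eta>\<close>.
\<close>
lemma is_monoid_R_iff: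
  "is_monoid (R V) (a, \<kappa>, \<nu>) m e \<longleftrightarrow>
     (\<exists>\<mu> \<eta>. m = (R_prodO V [(a, \<kappa>, \<nu>), (a, \<kappa>, \<nu>)], \<mu>, (a, \<kappa>, \<nu>)) \<and>
        e = (R_prodO V [], \<eta>, (a, \<kappa>, \<nu>)) \<and> is_unital_BiHom_monoid V a \<kappa> \<nu> \<mu> \<eta>)"
proof (cases "(a, \<kappa>, \<nu>) \<in> Obj (R V)")
  case False
  then show ?thesis
    by (auto simp: is_monoid_def is_semigroup_def is_unital_BiHom_monoid_def is_BiHom_monoid_def R_Obj)
next
  case A: True
  let ?A = "(a, \<kappa>, \<nu>)"
  have a: "a \<in> Obj V" and \<kappa>: "\<kappa> \<in> hom V a a" and \<nu>: "\<nu> \<in> hom V a a" using A by (auto simp: R_Obj)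
  have l: "Ident V a \<cdot> (\<nu> \<cdot> Lunit V a) = \<nu> \<cdot> Lunit V a"
    and r: "Ident V a \<cdot> (\<kappa> \<cdot> Runit V a) = \<kappa> \<cdot> Runit V a"
    using Comp_hom[OF Lunit_hom[OF a] \<nu>] Comp_hom[OF Runit_hom[OF a] \<kappa>] Comp_Ident_left by auto
  have hom: "e \<in> hom (R V) (R_prodO V []) ?A \<longleftrightarrow>
      (\<exists>\<eta>. e = (R_prodO V [], \<eta>, ?A) \<and> \<eta> \<in> hom V (Unit V) a \<and> \<kappa> \<cdot> \<eta> = \<eta> \<and> \<nu> \<cdot> \<eta> = \<eta>)"
    using A R_prodO_0_Obj Comp_Ident_right by (fastforce simp: R_prodO_def R_hom)
  show ?thesis
    unfolding is_monoid_def is_unital_BiHom_monoid_def is_semigroup_R_iff R_simps(1) hom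
    by (auto simp: R_prodM_def R_psi_0_1[OF A] R_psi_1_0[OF A] l r)
qed

text \<open>The structure-preserving arrows of \<open>BiHom_monoid_cat V\<close> are closed under composition.\<close>
lemma BiHom_arrow_Comp:
  assumes X: "is_BiHom_monoid V a \<kappa> \<nu> \<mu>" and Y: "is_BiHom_monoid V a' \<kappa>' \<nu>' \<mu>'"
    and Z: "is_BiHom_monoid V a'' \<kappa>'' \<nu>'' \<mu>''"
    and f: "f \<in> hom V a a'" "f \<cdot> \<kappa> = \<kappa>' \<cdot> f" "f \<cdot> \<nu> = \<nu>' \<cdot> f" "f \<cdot> \<mu> = \<mu>' \<cdot> (f \<otimes> f)"
    and g: "g \<in> hom V a' a''" "g \<cdot> \<kappa>' = \<kappa>'' \<cdot> g" "g \<cdot> \<nu>' = \<nu>'' \<cdot> g" "g \<cdot> \<mu>' = \<mu>'' \<cdot> (g \<otimes> g)"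
  shows "(g \<cdot> f) \<cdot> \<kappa> = \<kappa>'' \<cdot> (g \<cdot> f) \<and> (g \<cdot> f) \<cdot> \<nu> = \<nu>'' \<cdot> (g \<cdot> f) \<and>
    (g \<cdot> f) \<cdot> \<mu> = \<mu>'' \<cdot> ((g \<cdot> f) \<otimes> (g \<cdot> f))"
  using X Y Z square_Comp[OF f(1) g(1) f(1) g(1)]
    square_Comp[OF TensM_hom[OF f(1) f(1)] TensM_hom[OF g(1) g(1)] f(1) g(1)]
    TensM_Comp[OF f(1) g(1) f(1) g(1)] f g
  by (auto simp: is_BiHom_monoid_def)

lemma semigroup_cat_R_iso: "isomorphic_categories (semigroup_cat (R V)) (BiHom_monoid_cat V)"
  unfolding semigroup_cat_def BiHom_monoid_cat_def
proof (rule isomorphic_structured_cat_R[OF category_axioms, where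
      Fo = "\<lambda>((a, \<kappa>, \<nu>), (_, \<mu>, _)). (a, \<kappa>, \<nu>, \<mu>)"], goal_cases)
  case (1 X)
  then show ?case by (auto simp: is_semigroup_def)
next
  case 2
  show ?case
    by (rule bij_betw_byWitness[where
          f' = "\<lambda>(a, \<kappa>, \<nu>, \<mu>). ((a, \<kappa>, \<nu>), (R_prodO V [(a, \<kappa>, \<nu>), (a, \<kappa>, \<nu>)], \<mu>, (a, \<kappa>, \<nu>)))"])
      (auto simp: is_semigroup_R_iff)
next
  case (3 X)
  then show ?case by (auto split: prod.splits)
next
  case (4 X Y \<theta>)
  then show ?case
    by (auto simp: is_semigroup_R_iff R_hom R_prodM_def is_BiHom_monoid_def R_Obj)
next
  case (5 X)
  then show ?case
    by (auto simp: is_BiHom_monoid_def id_simps)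
next
  case (6 X Y Z f g)
  obtain a \<kappa> \<nu> \<mu> a' \<kappa>' \<nu>' \<mu>' a'' \<kappa>'' \<nu>'' \<mu>''
    where "X = (a, \<kappa>, \<nu>, \<mu>)" "Y = (a', \<kappa>', \<nu>', \<mu>')" "Z = (a'', \<kappa>'', \<nu>'', \<mu>'')"
    by (metis prod_cases4)
  then show ?case
    using 6 BiHom_arrow_Comp[of a \<kappa> \<nu> \<mu> a' \<kappa>' \<nu>' \<mu>' a'' \<kappa>'' \<nu>'' \<mu>'' f g] by simp
qed

lemma monoid_cat_R_iso: "isomorphic_categories (monoid_cat (R V)) (unital_BiHom_monoid_cat V)"
  unfolding monoid_cat_def unital_BiHom_monoid_cat_def
proof (rule isomorphic_structured_cat_R[OF category_axioms, where
      Fo = "\<lambda>((a, \<kappa>, \<nu>), (_, \<mu>, _), (_, \<eta>, _)). (a, \<kappa>, \<nu>, \<mu>, \<eta>)"], goal_cases)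
  case (1 X)
  then show ?case by (auto simp: is_monoid_def is_semigroup_def)
next
  case 2
  show ?case
    by (rule bij_betw_byWitness[where
          f' = "\<lambda>(a, \<kappa>, \<nu>, \<mu>, \<eta>). ((a, \<kappa>, \<nu>), (R_prodO V [(a, \<kappa>, \<nu>), (a, \<kappa>, \<nu>)], \<mu>, (a, \<kappa>, \<nu>)),
            (R_prodO V [], \<eta>, (a, \<kappa>, \<nu>)))"])
      (auto simp: is_monoid_R_iff)
next
  case (3 X)
  then show ?case by (auto split: prod.splits)
next
  case (4 X Y \<theta>)
  then show ?case
    by (auto simp: is_monoid_R_iff R_hom R_prodM_def is_unital_BiHom_monoid_def
        is_BiHom_monoid_def R_Obj)
next
  case (5 X)
  then show ?case
    by (auto simp: is_unital_BiHom_monoid_def is_BiHom_monoid_def id_simps)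
next
  case (6 X Y Z f g)
  obtain a \<kappa> \<nu> \<mu> \<eta> a' \<kappa>' \<nu>' \<mu>' \<eta>' a'' \<kappa>'' \<nu>'' \<mu>'' \<eta>''
    where "X = (a, \<kappa>, \<nu>, \<mu>, \<eta>)" "Y = (a', \<kappa>', \<nu>', \<mu>', \<eta>')" "Z = (a'', \<kappa>'', \<nu>'', \<mu>'', \<eta>'')"
    by (metis prod_cases5)
  then show ?case
    using 6 BiHom_arrow_Comp[of a \<kappa> \<nu> \<mu> a' \<kappa>' \<nu>' \<mu>' a'' \<kappa>'' \<nu>'' \<mu>'' f g]
      Comp_assoc[of \<eta> "Unit V" a f a' g a'']
    by (simp add: is_unital_BiHom_monoid_def)
qed

end

theorem theorem6p8:
  fixes V :: "('o, 'm) moncat"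
  assumes "monoidal_category V"
  shows "isomorphic_categories (semigroup_cat (R V)) (BiHom_monoid_cat V) \<and>
         isomorphic_categories (monoid_cat (R V)) (unital_BiHom_monoid_cat V)"
proof
  show "isomorphic_categories (semigroup_cat (R V)) (BiHom_monoid_cat V)"
    using assms by (rule monoidal_category.semigroup_cat_R_iso)
  show "isomorphic_categories (monoid_cat (R V)) (unital_BiHom_monoid_cat V)"
    using assms by (rule monoidal_category.monoid_cat_R_iso)
qed

end
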